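(* Let $H=\langle m_0,\dots,m_p,n\rangle$ be a numerical semigroup minimally generated by an almost arithmetic sequence, with associated data as in the context, and assume $W\ne\emptyset$. Suppose $r=1$ and $\lambda=1$. Then for each $\beta_j\in\mathrm{PF}_2(H)$, $j\in[1,p]$, there exists an $\mathrm{RF}$-matrix for $\beta_j$ whose rows (indexed by $0,1,\dots,p,n$) are: (1) row $0$: $-E_0+(q-1)E_p+(v-w-1)E_n+E_j$; (2) row $k$ for $k\in[1,p-j]$: $-E_k+(q-1)E_p+(v-w-1)E_n+E_{j+k}$; (3) row $k$ for $k=p-j+1$: $(\lambda-1)E_0-E_k+(v-1)E_n$; and row $k$ for $k\in[p-j+2,p]$: $(\nu-2)E_0-E_k+(w-1)E_n+E_{k+j-p-2}$; (4) row $n$: $(\nu-\epsilon)E_0+q_{z+j-p-1}E_p-E_n+E_{r_{z+j-p-1}}$, where $\epsilon=2$ if $r'+r_{z+j-p-1}\le p$ and $\epsilon=1$ if $r'+r_{z+j-p-1}>p$.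
   Context: Notation: $\mathbb N=\{0,1,2,\dots\}$; $[a,b]$ is the set of integers $i$ with $a\le i\le b$. Let $p\ge1$, $d\ge1$, $m_0\ge 1$ be integers, $m_i=m_0+id$ for $i\in[0,p]$, and $n\ge1$ an integer with $\gcd(m_0,d,n)=1$. Put $H'=\sum_{i=0}^p\mathbb Nm_i$ and $H=H'+\mathbb Nn=\langle m_0,\dots,m_p,n\rangle$; assume $\{m_0,\dots,m_p,n\}$ is a minimal generating set of $H$. $\mathrm{Ap}(H,m_0)=\{h\in H: h-m_0\notin H\}$. For $t\in\mathbb N$ write $t=q_tp+r_t$ with $q_t\in\mathbb Z$, $r_t\in[1,p]$, and set $g_t=q_tm_p+m_{r_t}$ (so $q_0=-1$, $r_0=p$, $g_0=0$). Let $u=\min\{t\in\mathbb N: g_t\notin\mathrm{Ap}(H,m_0)\}$ and $v=\min\{b\ge1: bn\in H'\}$. It is known (Patil–Singh) that there are unique integers $z\in[0,u-1]$, $w\in[0,v-1]$, $\lambda\ge1$, $\mu\ge0$ with $g_u=\lambda m_0+wn$, $vn=\mu m_0+g_z$, and $g_{u-z}+(v-w)n=\nu m_0$, where $\nu=\lambda+\mu+1$ if $r_{u-z}<r_u$ and $\nu=\lambda+\mu$ if $r_{u-z}\ge r_u$. Set $r=r_u$, $q=q_u$, $r'=r_{u-z}$, $q'=q_{u-z}$, and $W=[u-z,u-1]\times[v-w,v-1]$ (empty iff $z=0$ or $w=0$). $\mathrm{PF}(H)$ is the set of $f\in\mathbb Z\setminus H$ with $f+h\in H$ for all $h\in H\setminus\{0\}$.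 An $\mathrm{RF}$-matrix for $f\in\mathrm{PF}(H)$ is a $(p+2)\times(p+2)$ integer matrix with rows and columns indexed by $0,1,\dots,p,n$ (corresponding to the generators $m_0,\dots,m_p,n$), with all diagonal entries $-1$, all off-diagonal entries in $\mathbb N$, and such that each row $(b_0,\dots,b_p,b_n)$ satisfies $\sum_{j=0}^p b_jm_j+b_nn=f$. $E_0,\dots,E_p,E_n$ denote the standard basis vectors of $\mathbb Z^{p+2}$ (coordinates indexed by $0,\dots,p,n$). When $W\neq\emptyset$, let $\beta_j=g_{(q-1)p+r+j-1}+(v-w-1)n-m_0$ for $j\in[1,p]$. $\mathrm{PF}_2(H)$ denotes the set of pseudo-Frobenius numbers of $H$ of the form $\beta_j$ with $j\in[1,p]$ if $r=1$, and with $j\in[p-r+2,p]$ if $r\ge2$. *)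

theory Defs
  imports Main "Jordan_Normal_Form.Matrix"
begin

text \<open>Semigroups are subsets of the integers, so that pseudo-Frobenius numbers and the
  differences \<open>h - m0\<close> need no coercions and no truncated subtraction occurs.\<close>

inductive_set generated :: "int set \<Rightarrow> int set" for S :: "int set" where
  zero: "0 \<in> generated S"
| add: "a \<in> S \<Longrightarrow> x \<in> generated S \<Longrightarrow> a + x \<in> generated S"

definition minimal_generating_set :: "int set \<Rightarrow> int set \<Rightarrow> bool" where
  "minimal_generating_set S H \<longleftrightarrow> generated S = H \<and> (\<forall>T. T \<subset> S \<longrightarrow> generated T \<noteq> H)"

definition Apery :: "int set \<Rightarrow> int \<Rightarrow> int set" where
  "Apery H a = {h \<in> H. h - a \<notin> H}"

definition PF :: "int set \<Rightarrow> int set" where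
  "PF H = {f. f \<notin> H \<and> (\<forall>h \<in> H - {0}. f + h \<in> H)}"

definition gen :: "int \<Rightarrow> int \<Rightarrow> nat \<Rightarrow> int" where
  "gen m0 d i = m0 + int i * d"

definition arith_semigroup :: "nat \<Rightarrow> int \<Rightarrow> int \<Rightarrow> int set" where
  "arith_semigroup p m0 d = {\<Sum>i\<le>p. int (c i) * gen m0 d i | c :: nat \<Rightarrow> nat. True}"

definition almost_arith_semigroup :: "nat \<Rightarrow> int \<Rightarrow> int \<Rightarrow> int \<Rightarrow> int set" where
  "almost_arith_semigroup p m0 d n =
     {h + int b * n | h b. h \<in> arith_semigroup p m0 d}"

text \<open>\<open>t = quo p t * p + res p t\<close> with \<open>res p t\<close> in \<open>{1..p}\<close>; see \<open>quo_res_iff\<close> below.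
  The argument is an integer because an index such as \<open>z + j - p - 1\<close> must not be truncated.\<close>

definition quo :: "nat \<Rightarrow> int \<Rightarrow> int" where
  "quo p t = (t - 1) div int p"

definition res :: "nat \<Rightarrow> int \<Rightarrow> nat" where
  "res p t = nat ((t - 1) mod int p) + 1"

lemma quo_res_iff:
  assumes "p \<ge> 1"
  shows "quo p t = a \<and> res p t = b \<longleftrightarrow> b \<in> {1..p} \<and> t = a * int p + int b"
proof
  assume *: "quo p t = a \<and> res p t = b"
  have "(t - 1) mod int p \<ge> 0" "(t - 1) mod int p < int p"
    using assms by simp_all
  moreover have "(t - 1) div int p * int p + (t - 1) mod int p = t - 1"
    by (rule div_mult_mod_eq)
  ultimately show "b \<in> {1..p} \<and> t = a * int p + int b"
    using * by (auto simp: quo_def res_def)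
next
  assume *: "b \<in> {1..p} \<and> t = a * int p + int b"
  have "(t - 1) div int p = a \<and> (t - 1) mod int p = int b - 1"
    using * assms by (intro conjI int_div_pos_eq[of _ _ _ "int b - 1"]
      int_mod_pos_eq[of _ _ a]) (auto simp: algebra_simps)
  then show "quo p t = a \<and> res p t = b"
    using * by (auto simp: quo_def res_def)
qed

definition g :: "nat \<Rightarrow> int \<Rightarrow> int \<Rightarrow> int \<Rightarrow> int" where
  "g p m0 d t = quo p t * gen m0 d p + gen m0 d (res p t)"

definition u_min :: "nat \<Rightarrow> int \<Rightarrow> int \<Rightarrow> int \<Rightarrow> int" where
  "u_min p m0 d n =
     int (LEAST t. g p m0 d (int t) \<notin> Apery (almost_arith_semigroup p m0 d n) m0)"

definition v_min :: "nat \<Rightarrow> int \<Rightarrow> int \<Rightarrow> int \<Rightarrow> int" where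
  "v_min p m0 d n = int (LEAST b. b \<ge> 1 \<and> int b * n \<in> arith_semigroup p m0 d)"

text \<open>Rows and columns \<open>0, \<dots>, p\<close> correspond to \<open>m\<^sub>0, \<dots>, m\<^sub>p\<close>; row and column \<open>p + 1\<close>
  correspond to the generator \<open>n\<close>.\<close>

definition RF_matrix :: "nat \<Rightarrow> int \<Rightarrow> int \<Rightarrow> int \<Rightarrow> int \<Rightarrow> int mat \<Rightarrow> bool" where
  "RF_matrix p m0 d n f A \<longleftrightarrow>
     A \<in> carrier_mat (p + 2) (p + 2) \<and>
     (\<forall>i < p + 2. A $$ (i, i) = -1) \<and>
     (\<forall>i < p + 2. \<forall>j < p + 2. i \<noteq> j \<longrightarrow> A $$ (i, j) \<ge> 0) \<and>
     (\<forall>i < p + 2. (\<Sum>j\<le>p. A $$ (i, j) * gen m0 d j) + A $$ (i, p + 1) * n = f)"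

definition beta :: "nat \<Rightarrow> int \<Rightarrow> int \<Rightarrow> int \<Rightarrow> int \<Rightarrow> int \<Rightarrow> int \<Rightarrow> nat \<Rightarrow> int" where
  "beta p m0 d n u v w j =
     g p m0 d ((quo p u - 1) * int p + int (res p u) + int j - 1) + (v - w - 1) * n - m0"

definition PF2 :: "nat \<Rightarrow> int \<Rightarrow> int \<Rightarrow> int \<Rightarrow> int \<Rightarrow> int \<Rightarrow> int \<Rightarrow> int set" where
  "PF2 p m0 d n u v w =
     {f \<in> PF (almost_arith_semigroup p m0 d n).
        \<exists>j \<in> (if res p u = 1 then {1..p} else {p + 2 - res p u..p}). f = beta p m0 d n u v w j}"

end

theory Submission
  imports Defs
begin

text \<open>All computations take place in coordinates: \<open>g\<^sub>t = (q\<^sub>t + 1) m\<^sub>0 + t d\<close>, and \<open>H'\<close> consists of the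
  numbers \<open>s m\<^sub>0 + x d\<close> with \<open>0 \<le> x \<le> p s\<close>. For \<open>r = \<lambda> = 1\<close> one gets
  \<open>\<beta>\<^sub>j = (v - 1) n - m\<^bsub>p-j+1\<^esub>\<close>, and most row sums follow from the three defining relations.
  What remains is where \<open>\<beta>\<^sub>j \<in> PF(H)\<close> is needed. If \<open>j \<ge> 2\<close>, then
  \<open>\<beta>\<^sub>j + m\<^bsub>p-j+2\<^esub> = (v - 1) n + d \<in> H\<close>, and minimality of \<open>u\<close> and \<open>v\<close> forces \<open>z = u - 1\<close>, whence
  also \<open>\<mu> \<ge> 1\<close>. If \<open>j = 1\<close>, then \<open>\<beta>\<^sub>1 + n = v n - m\<^sub>p \<in> H\<close> forces \<open>z \<ge> p\<close>. The first fact gives the row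
  sums for \<open>k \<ge> p - j + 2\<close>, and both together make the entries of row \<open>n\<close> nonnegative.\<close>

section \<open>Division by \<open>p\<close> with residues in [1, p]\<close>

lemma quo_res_bounds:
  assumes "p \<ge> 1"
  shows "1 \<le> res p t" "res p t \<le> p" "t = quo p t * int p + int (res p t)"
  using quo_res_iff[OF assms, of t "quo p t" "res p t"] by auto

lemma quo_mono: "s \<le> t \<Longrightarrow> quo p s \<le> quo p t"
  by (cases "p = 0") (auto simp: quo_def intro: zdiv_mono1)

text \<open>As residues start at 1, \<open>quo p t + 1\<close> is t/p rounded up: for t \<ge> 0, the
  least number of generators with indices in [0, p] whose indices can add up to
  \<open>t\<close>.\<close>

lemma quo_less_iff:
  assumes "p \<ge> 1"
  shows "quo p t < s \<longleftrightarrow> t \<le> int p * s"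
proof
  assume "quo p t < s"
  then have "(quo p t + 1) * int p \<le> s * int p"
    by (intro mult_right_mono) auto
  then show "t \<le> int p * s"
    using quo_res_bounds[OF assms, of t] by (simp add: algebra_simps)
next
  assume "t \<le> int p * s"
  moreover have "quo p t * int p < t"
    using quo_res_bounds[OF assms, of t] by linarith
  ultimately have "quo p t * int p < s * int p"
    by (simp add: mult.commute)
  then show "quo p t < s"
    by (simp add: mult_less_cancel_right)
qed

lemma g_eq:
  assumes "p \<ge> 1"
  shows "g p m0 d t = (quo p t + 1) * m0 + t * d"
proof -
  have "t * d = (quo p t * int p + int (res p t)) * d"
    using quo_res_bounds(3)[OF assms, of t] by simp
  then show ?thesis
    by (simp add: g_def gen_def algebra_simps)
qed

section \<open>Coordinates on H' and H: number of summands and total index\<close>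

lemma sum_gen_in_arith_semigroup:
  "(\<Sum>i\<le>p. int (c i) * gen m0 d i) \<in> arith_semigroup p m0 d"
  by (auto simp: arith_semigroup_def)

lemma gen_in_arith_semigroup:
  assumes "i \<le> p"
  shows "gen m0 d i \<in> arith_semigroup p m0 d"
proof -
  have "gen m0 d i = (\<Sum>k\<le>p. int (if k = i then 1 else 0) * gen m0 d k)"
    using assms by (simp add: if_distrib if_distribR sum.delta cong: if_cong)
  then show ?thesis
    by (simp only: sum_gen_in_arith_semigroup)
qed

lemma arith_semigroup_add:
  assumes "x \<in> arith_semigroup p m0 d" and "y \<in> arith_semigroup p m0 d"
  shows "x + y \<in> arith_semigroup p m0 d"
proof -
  obtain a b where "x = (\<Sum>i\<le>p. int (a i) * gen m0 d i)" "y = (\<Sum>i\<le>p. int (b i) * gen m0 d i)"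
    using assms unfolding arith_semigroup_def by blast
  then have "x + y = (\<Sum>i\<le>p. int (a i + b i) * gen m0 d i)"
    by (simp add: sum.distrib algebra_simps)
  then show ?thesis
    by (simp only: sum_gen_in_arith_semigroup)
qed

lemma arith_semigroupI:
  assumes "p \<ge> 1" and "0 \<le> x" and "x \<le> int p * s"
  shows "s * m0 + x * d \<in> arith_semigroup p m0 d"
proof -
  have *: "int b * m0 + int a * d \<in> arith_semigroup p m0 d" if "a \<le> p * b" for a b
    using that
  proof (induction b arbitrary: a)
    case 0
    then show ?case
      using sum_gen_in_arith_semigroup[of "\<lambda>_. 0"] by simp
  next
    case (Suc b)
    \<comment> \<open>Greedy choice: the first summand takes index \<open>min a p\<close>, which
      leaves at most \<open>p * b\<close> for the other \<open>b\<close> summands.\<close>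
    have "gen m0 d (min a p) + (int b * m0 + int (a - min a p) * d) \<in> arith_semigroup p m0 d"
      using Suc by (intro arith_semigroup_add gen_in_arith_semigroup Suc.IH) auto
    moreover have "int a * d = int (min a p) * d + int (a - min a p) * d"
      by (simp flip: distrib_right of_nat_add)
    ultimately show ?case
      by (simp add: gen_def algebra_simps)
  qed
  have "s \<ge> 0"
    using order_trans[OF assms(2,3)] assms(1) by (simp add: zero_le_mult_iff)
  have "nat x \<le> p * nat s"
    using assms \<open>s \<ge> 0\<close> by (simp add: nat_le_iff)
  from *[OF this] show ?thesis
    using assms \<open>s \<ge> 0\<close> by simp
qed

lemma arith_semigroupE:
  assumes "h \<in> arith_semigroup p m0 d"
  obtains s x :: int where "0 \<le> s" "0 \<le> x" "x \<le> int p * s" "h = s * m0 + x * d"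
proof -
  obtain c where c: "h = (\<Sum>i\<le>p. int (c i) * gen m0 d i)"
    using assms unfolding arith_semigroup_def by blast
  show thesis
  proof
    show "0 \<le> (\<Sum>i\<le>p. int (c i))" "0 \<le> (\<Sum>i\<le>p. int (c i) * int i)"
      by (auto intro: sum_nonneg)
    show "(\<Sum>i\<le>p. int (c i) * int i) \<le> int p * (\<Sum>i\<le>p. int (c i))"
      unfolding sum_distrib_left
      by (intro sum_mono) (simp add: mult.commute mult_left_mono flip: of_nat_mult)
    show "h = (\<Sum>i\<le>p. int (c i)) * m0 + (\<Sum>i\<le>p. int (c i) * int i) * d"
      by (simp add: c gen_def sum.distrib distrib_left sum_distrib_right mult.assoc)
  qed
qed

lemma almost_arith_semigroupI:
  assumes "p \<ge> 1" and "0 \<le> x" and "x \<le> int p * s" and "0 \<le> b"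
  shows "s * m0 + x * d + b * n \<in> almost_arith_semigroup p m0 d n"
  using arith_semigroupI[OF assms(1-3), of m0 d] assms(4)
  unfolding almost_arith_semigroup_def by (auto intro!: exI[of _ "nat b"])

lemma almost_arith_semigroupE:
  assumes "h \<in> almost_arith_semigroup p m0 d n"
  obtains s x b :: int where "0 \<le> s" "0 \<le> x" "x \<le> int p * s" "0 \<le> b" "h = s * m0 + x * d + b * n"
proof -
  obtain h' b where *: "h' \<in> arith_semigroup p m0 d" "h = h' + int b * n"
    using assms unfolding almost_arith_semigroup_def by blast
  from *(1) obtain s x where "0 \<le> s" "0 \<le> x" "x \<le> int p * s" "h' = s * m0 + x * d"
    by (rule arith_semigroupE)
  then show thesis
    using * that[of s x "int b"] by simp
qed

section \<open>Consequences of the minimality of u and v\<close>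

lemma g_diff_notin:
  assumes "0 \<le> t" and "t < u_min p m0 d n"
  shows "g p m0 d t - m0 \<notin> almost_arith_semigroup p m0 d n"
proof -
  have "nat t < (LEAST t. g p m0 d (int t) \<notin> Apery (almost_arith_semigroup p m0 d n) m0)"
    using assms by (simp add: u_min_def)
  from not_less_Least[OF this] show ?thesis
    using assms(1) by (simp add: Apery_def)
qed

lemma mult_notin_arith_semigroup:
  assumes "1 \<le> b" and "b < v_min p m0 d n"
  shows "b * n \<notin> arith_semigroup p m0 d"
proof -
  have "nat b < (LEAST b. b \<ge> 1 \<and> int b * n \<in> arith_semigroup p m0 d)"
    using assms by (simp add: v_min_def)
  from not_less_Least[OF this] show ?thesis
    using assms(1) by simp
qed

text \<open>If z + 1 < u, the membership of (v - 1) n + d reduces to e n + d = s m0 with 0 < e < v.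
  Subtracting this from the relation for v n shifts \<open>z\<close> to \<open>z + 1\<close> and
  leaves (v - e) n on the left, against the minimality of \<open>v\<close> or of
  \<open>u\<close>.\<close>

lemma z_eq:
  fixes m0 d n u v z \<mu> :: int
  assumes "p \<ge> 1"
    and u: "u = u_min p m0 d n" and v: "v = v_min p m0 d n"
    and z: "1 \<le> z" "z \<le> u - 1"
    and vn: "v * n = \<mu> * m0 + g p m0 d z"
    and mem: "(v - 1) * n + d \<in> almost_arith_semigroup p m0 d n"
  shows "z = u - 1"
proof (rule ccontr)
  assume "z \<noteq> u - 1"
  obtain s x b where sxb: "0 \<le> s" "0 \<le> x" "x \<le> int p * s" "0 \<le> b"
    "(v - 1) * n + d = s * m0 + x * d + b * n"
    using mem by (rule almost_arith_semigroupE)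
  define e where "e = v - 1 - b"
  have e: "e * n + d = s * m0 + x * d"
    using sxb(5) by (simp add: e_def algebra_simps)
  have "e \<ge> 1"
  proof (rule ccontr)
    \<comment> \<open>Then \<open>d\<close>, which is g_1 - m0, lies in H although 1 < u.\<close>
    assume "\<not> e \<ge> 1"
    then have "s * m0 + x * d + (- e) * n \<in> almost_arith_semigroup p m0 d n"
      using assms(1) sxb by (intro almost_arith_semigroupI) auto
    moreover have "quo p 1 = 0"
      by (simp add: quo_def)
    then have "g p m0 d 1 - m0 = s * m0 + x * d + (- e) * n"
      using e by (simp add: g_eq[OF assms(1)])
    ultimately show False
      using g_diff_notin[of 1 p m0 d n] z u by simp
  qed
  have "e < v"
    using sxb(4) by (simp add: e_def)
  \<comment> \<open>Otherwise one \<open>d\<close> cancels and e n lies in H'.\<close>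
  have "x = 0"
  proof (rule ccontr)
    assume "x \<noteq> 0"
    then have "s * m0 + (x - 1) * d \<in> arith_semigroup p m0 d"
      using assms(1) sxb by (intro arith_semigroupI) auto
    moreover have "e * n = s * m0 + (x - 1) * d"
      using e by (simp add: algebra_simps)
    ultimately show False
      using mult_notin_arith_semigroup \<open>e \<ge> 1\<close> \<open>e < v\<close> v by metis
  qed
  define K where "K = \<mu> + quo p z + 1 - s"
  have eq: "(v - e) * n = K * m0 + (z + 1) * d"
    using vn e \<open>x = 0\<close> unfolding K_def g_eq[OF assms(1)] by (simp add: algebra_simps)
  have v': "1 \<le> v - e" "v - e < v"
    using \<open>e \<ge> 1\<close> sxb(4) by (auto simp: e_def)
  show False
  proof (cases "z + 1 \<le> int p * K")
    case True
    then have "(v - e) * n \<in> arith_semigroup p m0 d"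
      unfolding eq using assms(1) z by (intro arith_semigroupI) auto
    then show False
      using mult_notin_arith_semigroup v' v by metis
  next
    case False
    \<comment> \<open>Too few summands for the offset \<open>z + 1\<close>: adding the missing
      multiples of m0 to (v - e) n gives exactly g_{z+1} - m0.\<close>
    then have "K \<le> quo p (z + 1)"
      by (simp flip: quo_less_iff[OF assms(1)])
    then have "(quo p (z + 1) - K) * m0 + 0 * d + (v - e) * n \<in> almost_arith_semigroup p m0 d n"
      using assms(1) v' by (intro almost_arith_semigroupI) auto
    moreover have "(quo p (z + 1) - K) * m0 + 0 * d + (v - e) * n = g p m0 d (z + 1) - m0"
      unfolding eq g_eq[OF assms(1)] by (simp add: algebra_simps)
    ultimately show False
      using g_diff_notin[of "z + 1" p m0 d n] z u \<open>z \<noteq> u - 1\<close> by simp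
  qed
qed

text \<open>If z < p, adding m_p back gives a representation of v n with offset X \<ge> p > z. The
  larger offset forces fewer summands than in the relation through \<open>z\<close>, and exchanging
  the two representations puts g_X - m0 in H although X < u.\<close>

lemma p_le_z:
  fixes m0 d n u v z w q \<mu> :: int
  assumes "p \<ge> 1" and "m0 \<ge> 1" and "d \<ge> 1" and "n \<ge> 1"
    and u: "u = u_min p m0 d n" and v: "v = v_min p m0 d n"
    and z: "1 \<le> z" "z \<le> u - 1" and w: "1 \<le> w" "w \<le> v - 1"
    and vn: "v * n = \<mu> * m0 + g p m0 d z"
    and uq: "u = q * int p + 1" and wn: "q * m0 + u * d = w * n"
    and mem: "v * n - gen m0 d p \<in> almost_arith_semigroup p m0 d n"
  shows "int p \<le> z"
proof (rule ccontr)
  assume "\<not> int p \<le> z"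
  obtain s x b where sxb: "0 \<le> s" "0 \<le> x" "x \<le> int p * s" "0 \<le> b"
    "v * n - gen m0 d p = s * m0 + x * d + b * n"
    using mem by (rule almost_arith_semigroupE)
  define S where "S = s + 1"
  define X where "X = x + int p"
  have S: "0 \<le> X" "X \<le> int p * S" "z < X" "1 \<le> S"
    using sxb \<open>\<not> int p \<le> z\<close> by (auto simp: S_def X_def algebra_simps)
  have eq: "(v - b) * n = S * m0 + X * d"
    using sxb(5) by (simp add: S_def X_def gen_def algebra_simps)
  have "0 < S * m0" "0 \<le> X * d"
    using S assms by auto
  then have "0 < (v - b) * n"
    unfolding eq by linarith
  then have "1 \<le> v - b"
    using \<open>n \<ge> 1\<close> by (simp add: zero_less_mult_iff)
  have "b = 0"
  proof (rule ccontr)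
    assume "b \<noteq> 0"
    moreover have "(v - b) * n \<in> arith_semigroup p m0 d"
      unfolding eq using assms(1) S by (intro arith_semigroupI) auto
    ultimately show False
      using mult_notin_arith_semigroup[of "v - b" p m0 d n] \<open>1 \<le> v - b\<close> sxb(4) v by simp
  qed
  \<comment> \<open>Otherwise the relation for w n can be subtracted, leaving (v - w) n in H'; the
    offset bound survives because \<open>u\<close> exceeds \<open>q * int p\<close>.\<close>
  have "X < u"
  proof (rule ccontr)
    assume "\<not> X < u"
    then have "(S - q) * m0 + (X - u) * d \<in> arith_semigroup p m0 d"
      using assms(1) S uq by (intro arith_semigroupI) (auto simp: algebra_simps)
    moreover have "(v - w) * n = (S - q) * m0 + (X - u) * d"
      using eq wn \<open>b = 0\<close> by (simp add: algebra_simps)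
    ultimately show False
      using mult_notin_arith_semigroup[of "v - w" p m0 d n] w v by simp
  qed
  define c where "c = \<mu> + quo p z + 1"
  have eqs: "S * m0 + X * d = c * m0 + z * d"
    using vn eq \<open>b = 0\<close> unfolding c_def g_eq[OF assms(1)] by (simp add: algebra_simps)
  have "X * d > z * d"
    using S assms by simp
  then have "S * m0 < c * m0"
    using eqs by linarith
  then have "S < c"
    using assms by (simp add: mult_less_cancel_right)
  \<comment> \<open>With \<open>S < c\<close> this gives \<open>quo p X - S + c > quo p z\<close>,
    enough summands for the offset \<open>z\<close>.\<close>
  have "quo p z \<le> quo p X"
    using S by (intro quo_mono) simp
  moreover have "quo p X * m0 + X * d = (quo p X - S + c) * m0 + z * d"
    using eqs by (simp add: algebra_simps)
  ultimately have "quo p X * m0 + X * d \<in> almost_arith_semigroup p m0 d n"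
    using almost_arith_semigroupI[of p z "quo p X - S + c" 0 m0 d n] assms(1) z \<open>S < c\<close>
    by (simp flip: quo_less_iff[OF assms(1)])
  moreover have "quo p X * m0 + X * d = g p m0 d X - m0"
    by (simp add: g_eq[OF assms(1)] algebra_simps)
  ultimately show False
    using g_diff_notin[of X p m0 d n] S \<open>X < u\<close> u by simp
qed

text \<open>The value \<open>\<Sum>\<^sub>j b\<^sub>j m\<^sub>j + b\<^sub>n n\<close> of a row is its scalar product with this vector.\<close>

definition weights :: "nat \<Rightarrow> int \<Rightarrow> int \<Rightarrow> int \<Rightarrow> int vec" where
  "weights p m0 d n = vec (p + 2) (\<lambda>j. if j \<le> p then gen m0 d j else n)"

lemma weights_simps:
  "weights p m0 d n \<in> carrier_vec (p + 2)"
  "unit_vec (p + 2) (p + 1) \<bullet> weights p m0 d n = n"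
  "j \<le> p \<Longrightarrow> unit_vec (p + 2) j \<bullet> weights p m0 d n = m0 + int j * d"
proof -
  show c: "weights p m0 d n \<in> carrier_vec (p + 2)"
    by (simp add: weights_def)
  show "unit_vec (p + 2) (p + 1) \<bullet> weights p m0 d n = n"
    using scalar_prod_left_unit[OF c, of "p + 1"] by (simp add: weights_def)
  show "unit_vec (p + 2) j \<bullet> weights p m0 d n = m0 + int j * d" if "j \<le> p"
    using scalar_prod_left_unit[OF c, of j] that by (simp add: weights_def gen_def)
qed

text \<open>Rows stay combinations of unit vectors, so their values follow from linearity of the
  scalar product instead of entrywise sums.\<close>

lemma RF_matrix_of_rows:
  fixes R :: "nat \<Rightarrow> int vec"
  assumes "\<And>i. i < p + 2 \<Longrightarrow> R i \<in> carrier_vec (p + 2)"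
    and "\<And>i. i < p + 2 \<Longrightarrow> R i $ i = -1"
    and "\<And>i j. i < p + 2 \<Longrightarrow> j < p + 2 \<Longrightarrow> i \<noteq> j \<Longrightarrow> R i $ j \<ge> 0"
    and "\<And>i. i < p + 2 \<Longrightarrow> R i \<bullet> weights p m0 d n = f"
  obtains A where "RF_matrix p m0 d n f A" "\<And>i. i < p + 2 \<Longrightarrow> row A i = R i"
proof
  define A where "A = mat (p + 2) (p + 2) (\<lambda>(i, j). R i $ j)"
  show "row A i = R i" if "i < p + 2" for i
    using assms(1)[OF that] that by (auto simp: A_def)
  have "(\<Sum>j\<le>p. R i $ j * gen m0 d j) + R i $ (p + 1) * n = f" if "i < p + 2" for i
  proof -
    have "{0..<p + 2} = insert (p + 1) {..p}"
      by auto
    then have "R i \<bullet> weights p m0 d n = R i $ (p + 1) * n + (\<Sum>j\<le>p. R i $ j * gen m0 d j)"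
      by (simp add: scalar_prod_def weights_def)
    then show ?thesis
      using assms(4)[OF that] by simp
  qed
  then show "RF_matrix p m0 d n f A"
    using assms(2,3) unfolding RF_matrix_def by (auto simp: A_def)
qed

section \<open>The RF-matrix for r = \<lambda> = 1\<close>

theorem proposition4p8:
  fixes p r r' :: nat and m0 d n u v z w l \<mu> \<nu> q :: int
    and H :: "int set" and E :: "nat \<Rightarrow> int vec"
  assumes "p \<ge> 1" and "d \<ge> 1" and "m0 \<ge> 1" and "n \<ge> 1"
    and "gcd (gcd m0 d) n = 1"
    and "H = almost_arith_semigroup p m0 d n"
    and "minimal_generating_set (insert n (gen m0 d ` {0..p})) H"
    and "u = u_min p m0 d n" and "v = v_min p m0 d n"
    and "z \<in> {0..u - 1}" and "w \<in> {0..v - 1}" and "l \<ge> 1" and "\<mu> \<ge> 0"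
    and "g p m0 d u = l * m0 + w * n"
    and "v * n = \<mu> * m0 + g p m0 d z"
    and "g p m0 d (u - z) + (v - w) * n = \<nu> * m0"
    and "r = res p u" and "q = quo p u" and "r' = res p (u - z)"
    and "\<nu> = (if r' < r then l + \<mu> + 1 else l + \<mu>)"
    and "{u - z..u - 1} \<times> {v - w..v - 1} \<noteq> {}"
    and "r = 1" and "l = 1"
    and "E = unit_vec (p + 2)"
  shows "\<forall>j \<in> {1..p}. beta p m0 d n u v w j \<in> PF2 p m0 d n u v w \<longrightarrow>
    (\<exists>A. RF_matrix p m0 d n (beta p m0 d n u v w j) A \<and>
      row A 0 = - E 0 + (q - 1) \<cdot>\<^sub>v E p + (v - w - 1) \<cdot>\<^sub>v E (p + 1) + E j \<and>
      (\<forall>k \<in> {1..p - j}.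
        row A k = - E k + (q - 1) \<cdot>\<^sub>v E p + (v - w - 1) \<cdot>\<^sub>v E (p + 1) + E (j + k)) \<and>
      row A (p - j + 1) = (l - 1) \<cdot>\<^sub>v E 0 - E (p - j + 1) + (v - 1) \<cdot>\<^sub>v E (p + 1) \<and>
      (\<forall>k \<in> {p - j + 2..p}.
        row A k = (\<nu> - 2) \<cdot>\<^sub>v E 0 - E k + (w - 1) \<cdot>\<^sub>v E (p + 1) + E (k + j - (p + 2))) \<and>
      (let t = z + int j - int p - 1; \<epsilon> = (if r' + res p t \<le> p then 2 else 1) in
        row A (p + 1) = (\<nu> - \<epsilon>) \<cdot>\<^sub>v E 0 + quo p t \<cdot>\<^sub>v E p - E (p + 1) + E (res p t)))"
proof (intro ballI impI)
  fix j
  assume j: "j \<in> {1..p}" and "beta p m0 d n u v w j \<in> PF2 p m0 d n u v w"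
  define \<beta> where "\<beta> = beta p m0 d n u v w j"
  note p = \<open>p \<ge> 1\<close> and E = \<open>E = unit_vec (p + 2)\<close>
  have z: "1 \<le> z" "z \<le> u - 1" and w: "1 \<le> w" "w \<le> v - 1"
    using assms(10,11,21) by auto
  \<comment> \<open>The case r' < r is impossible, since r = 1.\<close>
  have nu: "\<nu> = \<mu> + 1"
    using quo_res_bounds(1)[OF p, of "u - z"] assms by simp
  have "res p u = 1"
    using assms(17,22) by simp
  then have uq: "u = q * int p + 1"
    using quo_res_bounds(3)[OF p, of u] assms(18) by simp
  have "q \<ge> 1"
    using uq z by (smt (verit) mult_nonpos_nonneg of_nat_0_le_iff)
  have wn: "q * m0 + u * d = w * n"
    using assms(14,18,23) by (simp add: g_eq[OF p] algebra_simps)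
  have vn: "v * n = \<mu> * m0 + (quo p z + 1) * m0 + z * d"
    using assms(15) by (simp add: g_eq[OF p])
  define qz rz where "qz = quo p z" and "rz = res p z"
  have rz: "1 \<le> rz" "rz \<le> p" "z = qz * int p + int rz"
    unfolding qz_def rz_def using quo_res_bounds[OF p] by auto
  have r': "r' = p + 1 - rz"
  proof -
    have "u - z = (q - qz - 1) * int p + int (p + 1 - rz)"
      using rz uq by (simp add: algebra_simps of_nat_diff)
    then show ?thesis
      using quo_res_iff[OF p, of "u - z" "q - qz - 1" "p + 1 - rz"] rz assms(19) by auto
  qed

  have "quo p ((q - 1) * int p + int j) = q - 1"
    using quo_res_iff[OF p, of _ "q - 1" j] j by auto
  then have "\<beta> = q * m0 + ((q - 1) * int p + int j) * d + (v - w - 1) * n - m0"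
    using \<open>res p u = 1\<close> assms(18) by (simp add: \<beta>_def beta_def g_eq[OF p])
  then have beta1: "\<beta> = (q - 1) * (m0 + int p * d) + (m0 + int j * d) + (v - w - 1) * n - m0"
    by (simp add: algebra_simps)
  \<comment> \<open>The multiples of m0 and \<open>d\<close> in \<open>beta1\<close> fall short of q
    m0 + u d = w n by the generator with index p + 1 - j.\<close>
  have beta2: "\<beta> = (v - 1) * n - (m0 + int (p + 1 - j) * d)"
    using beta1 wn uq j by (simp add: algebra_simps of_nat_diff)

  have "\<beta> \<in> PF H"
    using \<open>beta p m0 d n u v w j \<in> PF2 p m0 d n u v w\<close> assms(6) by (simp add: PF2_def \<beta>_def)
  then have PF: "\<beta> + h \<in> H" if "h \<in> H" "h > 0" for h
    using that unfolding PF_def by blast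

  have zu: "z = u - 1" and "\<mu> \<ge> 1" if "j \<ge> 2"
  proof -
    have "m0 + int (p + 2 - j) * d \<in> H"
      using almost_arith_semigroupI[OF p, of "int (p + 2 - j)" 1 0 m0 d n] that j assms(6) by simp
    moreover have "m0 + int (p + 2 - j) * d > 0"
      using assms(2,3) by (simp add: add_pos_nonneg)
    moreover have "\<beta> + (m0 + int (p + 2 - j) * d) = (v - 1) * n + d"
      using beta2 that j by (simp add: algebra_simps of_nat_diff)
    ultimately have "(v - 1) * n + d \<in> H"
      using PF by metis
    then show "z = u - 1"
      using z_eq[OF p assms(8,9) z assms(15)] assms(6) by simp
    then have "quo p z = q - 1"
      using quo_res_iff[OF p, of z "q - 1" p] uq p by (simp add: algebra_simps)
    \<comment> \<open>The left side is positive because w < v, so \<open>\<mu>\<close> cannot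
      vanish.\<close>
    then have "(v - w) * n + d = \<mu> * m0"
      using vn wn \<open>z = u - 1\<close> by (simp add: algebra_simps)
    moreover have "(v - w) * n + d > 0"
      using w assms(2,4) by (simp add: add_nonneg_pos)
    ultimately show "\<mu> \<ge> 1"
      using assms(3) by (smt (verit) mult_nonpos_nonneg)
  qed
  have pz: "int p \<le> z" if "j = 1"
  proof -
    have "n \<in> H"
      using almost_arith_semigroupI[OF p, of 0 0 1 m0 d n] assms(6) by simp
    then have "\<beta> + n \<in> H"
      using PF assms(4) by simp
    moreover have "\<beta> + n = v * n - gen m0 d p"
      using beta2 that by (simp add: gen_def algebra_simps)
    ultimately show ?thesis
      using p_le_z[OF p assms(3,2,4,8,9) z w assms(15) uq wn] assms(6) by simp
  qed

  define t where "t = z + int j - int p - 1"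
  define \<epsilon> :: int where "\<epsilon> = (if r' + res p t \<le> p then 2 else 1)"
  \<comment> \<open>For j = 1, t = z - p; for j \<ge> 2, z = q p gives t = (q - 1) p + j -
    1.\<close>
  have "t \<ge> 0"
  proof (cases "j = 1")
    case True
    then show ?thesis using pz by (simp add: t_def)
  next
    case False
    then have "t = (q - 1) * int p + (int j - 2) + 1"
      using zu j uq by (simp add: t_def algebra_simps)
    moreover have "0 \<le> (q - 1) * int p"
      using \<open>q \<ge> 1\<close> by simp
    moreover have "int j \<ge> 2"
      using False j by auto
    ultimately show ?thesis by linarith
  qed
  have rt: "1 \<le> res p t" "res p t \<le> p" "t = quo p t * int p + int (res p t)"
    using quo_res_bounds[OF p] by auto
  \<comment> \<open>\<open>\<epsilon>\<close> records the borrow in subtracting p + 1 - j from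
    \<open>z\<close>: without one, r' + \<open>res p t\<close> is j \<le> p; with one, it is p + j >
    p.\<close>
  have "quo p t = qz + \<epsilon> - 2" and eps: "\<epsilon> \<le> \<nu>"
  proof -
    show "quo p t = qz + \<epsilon> - 2"
    proof (cases "rz + j \<ge> p + 2")
      case True
      then have "quo p t = qz \<and> res p t = rz + j - (p + 1)"
        using rz j by (subst quo_res_iff[OF p]) (auto simp: t_def of_nat_diff)
      then show ?thesis using True r' rz j by (simp add: \<epsilon>_def)
    next
      case False
      then have "quo p t = qz - 1 \<and> res p t = rz + j - 1"
        using rz j by (subst quo_res_iff[OF p]) (auto simp: t_def of_nat_diff algebra_simps)
      then show ?thesis using False r' rz j by (simp add: \<epsilon>_def)
    qed
    \<comment> \<open>For j = 1 the borrow occurs, so \<open>\<epsilon>\<close> is 1; for j \<ge> 2,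
      \<open>\<mu> \<ge> 1\<close> gives \<open>\<nu> \<ge> 2\<close>.\<close>
    show "\<epsilon> \<le> \<nu>"
    proof (cases "j = 1")
      case True
      then have "quo p t = qz - 1 \<and> res p t = rz"
        using rz j by (subst quo_res_iff[OF p]) (auto simp: t_def algebra_simps)
      then show ?thesis using r' rz nu assms(13) by (simp add: \<epsilon>_def)
    next
      case False
      then show ?thesis using \<open>j \<ge> 2 \<Longrightarrow> \<mu> \<ge> 1\<close> j nu by (simp add: \<epsilon>_def)
    qed
  qed
  \<comment> \<open>\<open>quo p 0 = -1\<close> and \<open>res p 0 = p\<close>: the two contributions to column \<open>p\<close> cancel.\<close>
  have qt: "quo p t \<ge> 0 \<or> quo p t = -1 \<and> res p t = p"
  proof (cases "t = 0")
    case True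
    then show ?thesis using quo_res_iff[OF p, of 0 "-1" p] p by simp
  next
    case False
    then show ?thesis using \<open>t \<ge> 0\<close> p by (simp add: quo_def pos_imp_zdiv_nonneg_iff)
  qed

  define R where "R i =
    (if i = 0 then - E 0 + (q - 1) \<cdot>\<^sub>v E p + (v - w - 1) \<cdot>\<^sub>v E (p + 1) + E j
     else if i \<le> p - j then - E i + (q - 1) \<cdot>\<^sub>v E p + (v - w - 1) \<cdot>\<^sub>v E (p + 1) + E (j + i)
     else if i = p - j + 1 then (l - 1) \<cdot>\<^sub>v E 0 - E (p - j + 1) + (v - 1) \<cdot>\<^sub>v E (p + 1)
     else if i \<le> p then (\<nu> - 2) \<cdot>\<^sub>v E 0 - E i + (w - 1) \<cdot>\<^sub>v E (p + 1) + E (i + j - (p + 2))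
     else (\<nu> - \<epsilon>) \<cdot>\<^sub>v E 0 + quo p t \<cdot>\<^sub>v E p - E (p + 1) + E (res p t))" for i
  have ind: "E i $ k = (if k = i then 1 else 0)" if "k < p + 2" for i k
    using that by (cases "i < p + 2") (auto simp: E unit_vec_def)
  have carr [simp]: "E i \<in> carrier_vec (Suc (Suc p))" "dim_vec (E i) = Suc (Suc p)" for i
    by (simp_all add: E)
  have val [simp]: "weights p m0 d n \<in> carrier_vec (Suc (Suc p))"
    "dim_vec (weights p m0 d n) = Suc (Suc p)"
    "E (Suc p) \<bullet> weights p m0 d n = n"
    "i \<le> p \<Longrightarrow> E i \<bullet> weights p m0 d n = m0 + int i * d" for i
    using weights_simps[where p = p and ?m0.0 = m0 and d = d and n = n] by (auto simp: E)
  note sp = add_scalar_prod_distrib[of _ "Suc (Suc p)"] minus_scalar_prod_distrib[of _ "Suc (Suc p)"]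
    smult_scalar_prod_distrib[of _ "Suc (Suc p)"]
  have "\<exists>A. RF_matrix p m0 d n \<beta> A \<and> (\<forall>i < p + 2. row A i = R i)"
  proof (rule RF_matrix_of_rows[of p R m0 d n \<beta>])
    fix i assume i: "i < p + 2"
    show "R i \<in> carrier_vec (p + 2)"
      by (simp add: R_def)
    consider "i = 0" | "i \<noteq> 0" "i \<le> p - j" | "i = p - j + 1"
      | "i \<ge> p - j + 2" "i \<le> p" | "i = p + 1"
      using i by linarith
    note c = this
    \<comment> \<open>No positive term meets the diagonal: the term in column \<open>p\<close>
      occurs only in rows below \<open>p\<close> or in row n, and the last unit vector always has a
      different index from the row.\<close>
    show "R i $ i = -1"
      using c
      by cases (use j rt i in \<open>auto simp: R_def ind\<close>)
    \<comment> \<open>Rows with k \<ge> p - j + 2 exist only for j \<ge> 2, where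
      \<open>\<nu> - 2 = \<mu> - 1\<close> is nonnegative.\<close>
    show "R i $ k \<ge> 0" if "k < p + 2" "i \<noteq> k" for k
      using c
      by cases (use j rt i that qt eps nu w assms(13) \<open>q \<ge> 1\<close> \<open>l = 1\<close> \<open>j \<ge> 2 \<Longrightarrow> \<mu> \<ge> 1\<close> in
        \<open>auto simp: R_def ind\<close>)
    show "R i \<bullet> weights p m0 d n = \<beta>"
      using c
    proof cases
      case 1
      then show ?thesis
        using j beta1 by (simp add: R_def sp)
    next
      case 2
      then have "j + i \<le> p"
        using j by auto
      then show ?thesis
        using 2 j beta1 by (simp add: R_def sp algebra_simps)
    next
      case 3
      then have "R i = (l - 1) \<cdot>\<^sub>v E 0 - E i + (v - 1) \<cdot>\<^sub>v E (p + 1)"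
        and *: "i \<le> p" "p + 1 - j = i"
        using j by (auto simp: R_def)
      then have "R i \<bullet> weights p m0 d n = (v - 1) * n - (m0 + int i * d)"
        using \<open>l = 1\<close> by (simp add: sp)
      then show ?thesis
        unfolding beta2 * .
    next
      case 4
      then have "j \<ge> 2" by simp
      define a where "a = i + j - (p + 2)"
      have a: "a \<le> p" "int a = int i + int j - int p - 2"
        using 4 j by (auto simp: a_def)
      have "R i = (\<nu> - 2) \<cdot>\<^sub>v E 0 - E i + (w - 1) \<cdot>\<^sub>v E (p + 1) + E a"
        using 4 j by (auto simp: R_def a_def)
      then have R: "R i \<bullet> weights p m0 d n
          = (\<mu> - 1) * m0 - (m0 + int i * d) + (w - 1) * n + (m0 + int a * d)"
        using 4 a(1) by (simp add: sp nu)
      have "quo p z = q - 1"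
        using quo_res_iff[OF p, of z "q - 1" p] uq p zu[OF \<open>j \<ge> 2\<close>] by (simp add: algebra_simps)
      \<comment> \<open>As z = u - 1, the relations for v n and w n differ by \<open>\<mu>\<close>
        copies of m0 and one \<open>d\<close>.\<close>
      then have "v * n = \<mu> * m0 + w * n - d"
        using vn wn zu[OF \<open>j \<ge> 2\<close>] by (simp add: algebra_simps)
      then show ?thesis
        using j unfolding R beta2 a(2) by (simp add: algebra_simps of_nat_diff)
    next
      case 5
      have "(\<nu> - \<epsilon>) * m0 + quo p t * (m0 + int p * d) - n + (m0 + int (res p t) * d)
        = (\<nu> - \<epsilon>) * m0 + (quo p t + 1) * m0 + (quo p t * int p + int (res p t)) * d - n"
        by (simp add: algebra_simps)
      also have "\<dots> = (\<nu> - \<epsilon>) * m0 + (quo p t + 1) * m0 + t * d - n"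
        using rt(3) by simp
      \<comment> \<open>\<open>\<epsilon>\<close> cancels: the coefficient of m0 becomes
        \<open>\<mu> + qz\<close>, one less than in the relation for v n.\<close>
      also have "\<dots> = \<beta>"
        using beta2 vn j unfolding \<open>quo p t = qz + \<epsilon> - 2\<close>
        by (simp add: qz_def nu t_def algebra_simps of_nat_diff)
      finally have "(\<nu> - \<epsilon>) * m0 + quo p t * (m0 + int p * d) - n + (m0 + int (res p t) * d) = \<beta>" .
      moreover have "R i = (\<nu> - \<epsilon>) \<cdot>\<^sub>v E 0 + quo p t \<cdot>\<^sub>v E p - E (p + 1) + E (res p t)"
        using 5 j by (auto simp: R_def)
      ultimately show ?thesis
        using rt by (simp add: sp)
    qed
  qed blast
  then obtain A where A: "RF_matrix p m0 d n \<beta> A" "\<And>i. i < p + 2 \<Longrightarrow> row A i = R i"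
    by blast
  show "\<exists>A. RF_matrix p m0 d n (beta p m0 d n u v w j) A \<and>
      row A 0 = - E 0 + (q - 1) \<cdot>\<^sub>v E p + (v - w - 1) \<cdot>\<^sub>v E (p + 1) + E j \<and>
      (\<forall>k \<in> {1..p - j}.
        row A k = - E k + (q - 1) \<cdot>\<^sub>v E p + (v - w - 1) \<cdot>\<^sub>v E (p + 1) + E (j + k)) \<and>
      row A (p - j + 1) = (l - 1) \<cdot>\<^sub>v E 0 - E (p - j + 1) + (v - 1) \<cdot>\<^sub>v E (p + 1) \<and>
      (\<forall>k \<in> {p - j + 2..p}.
        row A k = (\<nu> - 2) \<cdot>\<^sub>v E 0 - E k + (w - 1) \<cdot>\<^sub>v E (p + 1) + E (k + j - (p + 2))) \<and>
      (let t = z + int j - int p - 1; \<epsilon> = (if r' + res p t \<le> p then 2 else 1) in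
        row A (p + 1) = (\<nu> - \<epsilon>) \<cdot>\<^sub>v E 0 + quo p t \<cdot>\<^sub>v E p - E (p + 1) + E (res p t))"
    using A j by (intro exI[of _ A])
      (auto simp: R_def \<beta>_def Let_def simp flip: t_def \<epsilon>_def)
qed

end
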